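(* There is a bijection $\pi\mapsto f$ between the set of all permutations $\pi$ of $\{1,\ldots,n\}$ and the set of excedant functions $f:\{1,\ldots,n\}\to\{1,\ldots,n\}$ such that, for each $\pi$, a number $k\in\{1,\ldots,n\}$ does not belong to $\{f(1),\ldots,f(n)\}$ if and only if $\pi(i+1)=k$ for some descent $i$ of $\pi$.
   Context: A function $f$ on a set of integers is excedant if $f(i)\ge i$ for all $i$. A descent of a permutation $\pi$ of $\{1,\ldots,n\}$ is an $i\in\{1,\ldots,n-1\}$ with $\pi(i)>\pi(i+1)$. *)

theory Defs
  imports Main "HOL-Library.FuncSet" "HOL-Combinatorics.Permutations"
begin

definition excedant_on :: "nat set \<Rightarrow> (nat \<Rightarrow> nat) \<Rightarrow> bool" where
  "excedant_on A f \<longleftrightarrow> (\<forall>i\<in>A. f i \<ge> i)"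

text \<open>Functions on {1..n} are taken from the extensional function space, so that two of them
  are equal iff they agree on {1..n}.\<close>

definition excedant_funs :: "nat \<Rightarrow> (nat \<Rightarrow> nat) set" where
  "excedant_funs n = {f \<in> {1..n} \<rightarrow>\<^sub>E {1..n}. excedant_on {1..n} f}"

definition descents :: "nat \<Rightarrow> (nat \<Rightarrow> nat) \<Rightarrow> nat set" where
  "descents n \<pi> = {i \<in> {1..<n}. \<pi> i > \<pi> (i + 1)}"

end

theory Submission
  imports Defs "HOL-Combinatorics.Multiset_Permutations"
begin

text \<open>The bijection is built by adding a new smallest letter b to the alphabet A. Let M be the set
  of descent bottoms of a word u on A, respectively the set of values missed by an excedant
  function g on A. Extending g by v at b turns M into (M + b) - v. On the side of words, the same
  effect is obtained by inserting b in front of v if v is a letter of u other than the first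
  one, at the front if v = b, and at the end if v is the first letter of u, which is never a
  descent bottom.\<close>

section \<open>Descent bottoms of words\<close>

fun descent_bottoms :: "'a::linorder list \<Rightarrow> 'a set" where
  "descent_bottoms (x # y # zs) = (if y < x then {y} else {}) \<union> descent_bottoms (y # zs)"
| "descent_bottoms _ = {}"

lemma descent_bottoms_subset: "descent_bottoms xs \<subseteq> set (tl xs)"
  by (induction xs rule: descent_bottoms.induct) auto

lemma hd_notin_descent_bottoms:
  assumes "distinct xs" "xs \<noteq> []"
  shows "hd xs \<notin> descent_bottoms xs"
  using assms descent_bottoms_subset[of xs] by (cases xs) auto

lemma descent_bottoms_append:
  assumes "xs \<noteq> []"
  shows "descent_bottoms (xs @ y # ys) =
    descent_bottoms xs \<union> (if y < last xs then {y} else {}) \<union> descent_bottoms (y # ys)"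
  using assms by (induction xs rule: descent_bottoms.induct) auto

text \<open>The recursive form suits cutting and gluing of lists. This positional form links it to
  \<open>descents\<close>, which speaks of indices.\<close>

lemma descent_bottoms_conv_nth:
  "descent_bottoms xs = {xs ! Suc i |i. Suc i < length xs \<and> xs ! Suc i < xs ! i}"
proof (induction xs rule: descent_bottoms.induct)
  case (1 x y zs)
  have "(\<exists>i. k = (x # y # zs) ! Suc i \<and> Suc i < length (x # y # zs) \<and>
            (x # y # zs) ! Suc i < (x # y # zs) ! i) \<longleftrightarrow>
        k = y \<and> y < x \<or>
        (\<exists>i. k = (y # zs) ! Suc i \<and> Suc i < length (y # zs) \<and> (y # zs) ! Suc i < (y # zs) ! i)"
    (is "?L \<longleftrightarrow> ?R") for k
  proof
    assume ?L
    then obtain i where "k = (x # y # zs) ! Suc i" "Suc i < length (x # y # zs)"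
      "(x # y # zs) ! Suc i < (x # y # zs) ! i" by blast
    then show ?R by (cases i) auto
  next
    assume ?R
    then show ?L
    proof (elim disjE exE conjE)
      assume "k = y" "y < x"
      then show ?L by (intro exI[of _ 0]) auto
    next
      fix i assume "k = (y # zs) ! Suc i" "Suc i < length (y # zs)" "(y # zs) ! Suc i < (y # zs) ! i"
      then show ?L by (intro exI[of _ "Suc i"]) auto
    qed
  qed
  then show ?case using 1 by auto
qed auto

section \<open>Inserting a new letter into a word\<close>

text \<open>Inserting \<open>b\<close> in front of the first letter would give the same word as the
  choice \<open>v = b\<close>, so the choice \<open>v = hd u\<close> is sent to the one free slot,
  the end. For \<open>u = []\<close> the only admissible \<open>v\<close> is \<open>b\<close>, so
  \<open>hd []\<close> is never consulted.\<close>

definition insert_before :: "'a \<Rightarrow> 'a list \<Rightarrow> 'a \<Rightarrow> 'a list" where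
  "insert_before b u v =
    (if v = b then b # u
     else if v = hd u then u @ [b]
     else takeWhile (\<lambda>x. x \<noteq> v) u @ b # dropWhile (\<lambda>x. x \<noteq> v) u)"

lemma insert_before_split:
  assumes "distinct (xs @ v # ys)" "b \<notin> set (xs @ v # ys)" "xs \<noteq> []"
  shows "insert_before b (xs @ v # ys) v = xs @ b # v # ys"
proof -
  have "takeWhile (\<lambda>x. x \<noteq> v) (xs @ v # ys) = xs" "dropWhile (\<lambda>x. x \<noteq> v) (xs @ v # ys) = v # ys"
    using assms by (auto simp: takeWhile_append dropWhile_append)
  moreover have "v \<noteq> hd (xs @ v # ys)"
    using assms by (cases xs) auto
  ultimately show ?thesis
    using assms unfolding insert_before_def by auto
qed

lemma insert_before_cases [consumes 3, case_names front last inner]: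
  assumes "distinct u" "b \<notin> set u" "v \<in> insert b (set u)"
  obtains "v = b" "insert_before b u v = b # u"
  | ys where "u = v # ys" "v \<noteq> b" "insert_before b u v = u @ [b]"
  | xs ys where "u = xs @ v # ys" "xs \<noteq> []" "v \<noteq> b" "insert_before b u v = xs @ b # v # ys"
proof (cases "v = b")
  case True
  then show ?thesis using that(1) by (simp add: insert_before_def)
next
  case False
  with assms obtain xs ys where u: "u = xs @ v # ys"
    by (metis insertE split_list)
  show ?thesis
  proof (cases "xs = []")
    case True
    then show ?thesis using that(2) u False by (simp add: insert_before_def)
  next
    case xs: False
    then show ?thesis
      using that(3)[OF u xs False] insert_before_split assms u by metis
  qed
qed

text \<open>As \<open>b\<close> is least, it becomes a descent bottom wherever it has a predecessor,
  and the letter after it cannot be one. All adjacent pairs away from \<open>b\<close> are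
  unchanged. At the front nothing is gained; at the end nothing is lost, since the removed value
  \<open>v\<close> is the first letter of \<open>u\<close>.\<close>

lemma descent_bottoms_insert_before:
  assumes "distinct u" "\<And>x. x \<in> set u \<Longrightarrow> b < x" "v \<in> insert b (set u)"
  shows "descent_bottoms (insert_before b u v) = insert b (descent_bottoms u) - {v}"
proof -
  have b: "b \<notin> set u" using assms(2) by blast
  then have b': "b \<notin> descent_bottoms u"
    using descent_bottoms_subset[of u] by (cases u) auto
  from assms(1) b assms(3) show ?thesis
  proof (cases rule: insert_before_cases)
    case front
    have "descent_bottoms (b # u) = descent_bottoms u"
      using assms(2) by (cases u) (auto dest: less_asym)
    then show ?thesis using front b' by auto
  next
    case (last ys)
    then have "descent_bottoms (u @ [b]) = insert b (descent_bottoms u)"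
      using assms(2)[of "List.last u"] last_in_set[of u] by (subst descent_bottoms_append) auto
    moreover have "v \<notin> descent_bottoms u"
      using hd_notin_descent_bottoms[of u] assms(1) last by auto
    ultimately show ?thesis using last by auto
  next
    case (inner xs ys)
    have "b < List.last xs" "b < v"
      using assms(2) inner by auto
    then have "descent_bottoms (xs @ b # v # ys)
        = insert b (descent_bottoms xs \<union> descent_bottoms (v # ys))"
      using inner by (subst descent_bottoms_append) auto
    moreover have "v \<notin> descent_bottoms xs"
      using descent_bottoms_subset[of xs] assms(1) inner by (cases xs) auto
    moreover have "v \<notin> descent_bottoms (v # ys)"
      using hd_notin_descent_bottoms[of "v # ys"] assms(1) inner by auto
    ultimately show ?thesis
      using inner by (auto simp: descent_bottoms_append)
  qed
qed

text \<open>Deleting \<open>b\<close> from the word recovers \<open>u\<close>, and the place of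
  \<open>b\<close> recovers \<open>v\<close>.\<close>

lemma insert_before_inject:
  assumes "distinct u" "b \<notin> set u" "v \<in> insert b (set u)"
    and "distinct u'" "b \<notin> set u'" "v' \<in> insert b (set u')"
    and eq: "insert_before b u v = insert_before b u' v'"
  shows "u = u' \<and> v = v'"
proof -
  \<comment> \<open>A uniform decoding rule: with \<open>b\<close> between \<open>xs\<close> and
    \<open>ys\<close>, the value \<open>v\<close> is \<open>b\<close> if nothing precedes
    \<open>b\<close>, the first letter of \<open>u\<close> if \<open>b\<close> is last but not
    first, and otherwise the letter right after \<open>b\<close>.\<close>
  have split: "\<exists>xs ys. u = xs @ ys \<and> insert_before b u v = xs @ b # ys \<and>
      v = (if xs = [] then b else if ys = [] then hd xs else hd ys)"
    if "distinct u" "b \<notin> set u" "v \<in> insert b (set u)" for u v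
    using that
  proof (cases rule: insert_before_cases)
    case front
    then show ?thesis by (intro exI[of _ "[]"] exI[of _ u]) auto
  next
    case (last ys)
    then show ?thesis by (intro exI[of _ u] exI[of _ "[]"]) auto
  next
    case (inner xs ys)
    then show ?thesis by (intro exI[of _ xs] exI[of _ "v # ys"]) auto
  qed
  obtain xs ys where 1: "u = xs @ ys" "insert_before b u v = xs @ b # ys"
      "v = (if xs = [] then b else if ys = [] then hd xs else hd ys)"
    using split[OF assms(1-3)] by blast
  obtain xs' ys' where 2: "u' = xs' @ ys'" "insert_before b u' v' = xs' @ b # ys'"
      "v' = (if xs' = [] then b else if ys' = [] then hd xs' else hd ys')"
    using split[OF assms(4-6)] by blast
  \<comment> \<open>The letter \<open>b\<close> occurs exactly once, so the word can be cut at
    \<open>b\<close> in only one way.\<close>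
  have "xs = xs' \<and> ys = ys'"
    using eq 1 2 assms(2,5) append_Cons_eq_iff[of b xs ys xs' ys'] by simp
  then show ?thesis using 1 2 by simp
qed

lemma bij_betw_insert_before:
  assumes "b \<notin> A"
  shows "bij_betw (\<lambda>(u, v). insert_before b u v)
    (permutations_of_set A \<times> insert b A) (permutations_of_set (insert b A))"
  unfolding bij_betw_def
proof (intro conjI equalityI subsetI)
  show "inj_on (\<lambda>(u, v). insert_before b u v) (permutations_of_set A \<times> insert b A)"
  proof (rule inj_onI, clarify)
    fix u v u' v'
    assume "u \<in> permutations_of_set A" "v \<in> insert b A"
      "u' \<in> permutations_of_set A" "v' \<in> insert b A"
      "insert_before b u v = insert_before b u' v'"
    then show "u = u' \<and> v = v'"
      using assms insert_before_inject[of u b v u' v'] by (simp add: permutations_of_set_def)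
  qed
next
  fix w assume "w \<in> (\<lambda>(u, v). insert_before b u v) ` (permutations_of_set A \<times> insert b A)"
  then obtain u v where w: "w = insert_before b u v" "set u = A" "distinct u" "v \<in> insert b (set u)"
    by (auto simp: permutations_of_set_def)
  from w(3) _ w(4) show "w \<in> permutations_of_set (insert b A)"
    by (cases rule: insert_before_cases) (use assms w in \<open>auto simp: permutations_of_set_def\<close>)
next
  fix w assume "w \<in> permutations_of_set (insert b A)"
  then have w: "set w = insert b A" "distinct w" by (auto simp: permutations_of_set_def)
  then obtain xs ys where xy: "w = xs @ b # ys" by (metis insertI1 split_list)
  have u: "xs @ ys \<in> permutations_of_set A"
    using w xy assms by (auto simp: permutations_of_set_def)
  have "\<exists>v \<in> insert b A. insert_before b (xs @ ys) v = w"
  proof -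
    \<comment> \<open>The same decoding gives a preimage: \<open>b\<close> stands first, last but
      not first, or has neighbours on both sides.\<close>
    consider "xs = []" | x xs' where "xs = x # xs'" "ys = []" | y ys' where "xs \<noteq> []" "ys = y # ys'"
      by (metis list.exhaust)
    then show ?thesis
    proof cases
      case 1
      then show ?thesis using xy by (intro bexI[of _ b]) (auto simp: insert_before_def)
    next
      case 2
      then show ?thesis using xy w by (intro bexI[of _ x]) (auto simp: insert_before_def)
    next
      case 3
      then show ?thesis
        using xy w insert_before_split[of xs y ys' b] by (intro bexI[of _ y]) auto
    qed
  qed
  then show "w \<in> (\<lambda>(u, v). insert_before b u v) ` (permutations_of_set A \<times> insert b A)"
    using u by force
qed

section \<open>Extending an excedant function to a new least point\<close>

text \<open>Minimality of \<open>b\<close> enters twice: any value in \<open>insert b A\<close> is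
  allowed at \<open>b\<close>, and an excedant function cannot take the value \<open>b\<close> on
  \<open>A\<close>, so its restriction maps \<open>A\<close> to itself.\<close>

lemma bij_betw_excedant_insert:
  assumes "\<And>x. x \<in> A \<Longrightarrow> b < x"
  shows "bij_betw (\<lambda>(g, v). g(b := v))
    ({g \<in> A \<rightarrow>\<^sub>E A. excedant_on A g} \<times> insert b A)
    {f \<in> insert b A \<rightarrow>\<^sub>E insert b A. excedant_on (insert b A) f}"
proof -
  have b: "b \<notin> A" using assms by blast
  show ?thesis
  \<comment> \<open>The inverse reads off the value at \<open>b\<close> and resets it to
    \<open>undefined\<close>, the default of the extensional function space outside
    \<open>A\<close>.\<close>
  proof (rule bij_betw_byWitness[where f' = "\<lambda>f. (f(b := undefined), f b)"])
    show "\<forall>f \<in> {f \<in> insert b A \<rightarrow>\<^sub>E insert b A. excedant_on (insert b A) f}.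
        (\<lambda>(g, v). g(b := v)) (f(b := undefined), f b) = f"
      by simp
    have "g(b := undefined) = g" if "g \<in> A \<rightarrow>\<^sub>E A" for g
      using PiE_arb[OF that b] by (rule fun_upd_idem)
    then show "\<forall>p \<in> {g \<in> A \<rightarrow>\<^sub>E A. excedant_on A g} \<times> insert b A.
        (\<lambda>f. (f(b := undefined), f b)) ((\<lambda>(g, v). g(b := v)) p) = p"
      by (auto simp del: insert_iff)
    have "g(b := v) \<in> insert b A \<rightarrow>\<^sub>E insert b A \<and> excedant_on (insert b A) (g(b := v))"
      if "g \<in> A \<rightarrow>\<^sub>E A" "excedant_on A g" "v \<in> insert b A" for g v
    proof -
      have "b \<le> v" using that(3) assms less_imp_le by blast
      moreover have "g(b := v) \<in> insert b A \<rightarrow>\<^sub>E insert b A"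
        using that(1,3) by (auto simp: PiE_iff extensional_def)
      ultimately show ?thesis
        using that(2) by (simp add: excedant_on_def)
    qed
    then show "(\<lambda>(g, v). g(b := v)) ` ({g \<in> A \<rightarrow>\<^sub>E A. excedant_on A g} \<times> insert b A)
        \<subseteq> {f \<in> insert b A \<rightarrow>\<^sub>E insert b A. excedant_on (insert b A) f}"
      by (auto simp del: insert_iff)
    have "f(b := undefined) \<in> A \<rightarrow>\<^sub>E A \<and> excedant_on A (f(b := undefined)) \<and> f b \<in> insert b A"
      if f: "f \<in> insert b A \<rightarrow>\<^sub>E insert b A" "excedant_on (insert b A) f" for f
    proof (intro conjI PiE_I)
      fix x assume "x \<in> A"
      then have "f x \<in> insert b A" "x \<le> f x" "b < x"
        using f assms by (auto simp: excedant_on_def)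
      then show "(f(b := undefined)) x \<in> A" by auto
    next
      fix x assume "x \<notin> A"
      then show "(f(b := undefined)) x = undefined"
        using PiE_arb[OF f(1), of x] by simp
    next
      show "excedant_on A (f(b := undefined))"
        using f(2) b by (auto simp: excedant_on_def)
      show "f b \<in> insert b A"
        using f(1) by blast
    qed
    then show "(\<lambda>f. (f(b := undefined), f b)) `
          {f \<in> insert b A \<rightarrow>\<^sub>E insert b A. excedant_on (insert b A) f}
        \<subseteq> {g \<in> A \<rightarrow>\<^sub>E A. excedant_on A g} \<times> insert b A"
      by (auto simp del: insert_iff)
  qed
qed

text \<open>Arbitrary finite sets are needed for the induction: removing the least element from
  \<open>{1..n}\<close> does not leave an interval starting at 1.\<close>

lemma ex_bij_permutations_excedant:
  assumes "finite A"
  shows "\<exists>\<phi>. bij_betw \<phi> (permutations_of_set A) {f \<in> A \<rightarrow>\<^sub>E A. excedant_on A f} \<and>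
    (\<forall>w \<in> permutations_of_set A. A - \<phi> w ` A = descent_bottoms w)"
  using assms
proof (induction rule: finite_linorder_min_induct)
  case empty
  show ?case
    \<comment> \<open>The empty word goes to the only extensional function on the empty set.\<close>
    by (intro exI[of _ "\<lambda>_ _. undefined"]) (auto simp: bij_betw_def excedant_on_def)
next
  case (insert b A)
  then have less: "\<And>x. x \<in> A \<Longrightarrow> b < x" by blast
  then have b: "b \<notin> A" by blast
  let ?F = "\<lambda>A. {f \<in> A \<rightarrow>\<^sub>E A. excedant_on A f}"
  obtain \<phi> where \<phi>: "bij_betw \<phi> (permutations_of_set A) (?F A)"
    and db: "\<And>w. w \<in> permutations_of_set A \<Longrightarrow> A - \<phi> w ` A = descent_bottoms w"
    using insert.IH by blast
  let ?X = "permutations_of_set A \<times> insert b A"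
  let ?ins = "\<lambda>(u, v). insert_before b u v"
  define ext where "ext = (\<lambda>(g, v). g(b := v)) \<circ> map_prod \<phi> id"
  have ins: "bij_betw ?ins ?X (permutations_of_set (insert b A))"
    using bij_betw_insert_before b .
  have ext: "bij_betw ext ?X (?F (insert b A))"
    unfolding ext_def
    by (rule bij_betw_trans[OF bij_betw_map_prod[OF \<phi> bij_betw_id] bij_betw_excedant_insert[OF less]])
  \<comment> \<open>Decode \<open>w\<close> as a pair \<open>(u, v)\<close>, then extend
    \<open>\<phi> u\<close> by the value \<open>v\<close> at \<open>b\<close>.\<close>
  define \<psi> where "\<psi> = ext \<circ> inv_into ?X ?ins"
  have "bij_betw \<psi> (permutations_of_set (insert b A)) (?F (insert b A))"
    unfolding \<psi>_def using bij_betw_inv_into[OF ins] ext by (rule bij_betw_trans)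
  moreover have "insert b A - \<psi> w ` insert b A = descent_bottoms w"
    if w: "w \<in> permutations_of_set (insert b A)" for w
  proof -
    have "w \<in> ?ins ` ?X"
      using w bij_betw_imp_surj_on[OF ins] by simp
    then obtain u v where
      uv: "u \<in> permutations_of_set A" "v \<in> insert b A" "w = insert_before b u v"
      by (auto simp del: insert_iff)
    have "inv_into ?X ?ins w = (u, v)"
      using bij_betw_inv_into_left[OF ins, of "(u, v)"] uv by auto
    then have "\<psi> w = (\<phi> u)(b := v)"
      by (simp add: \<psi>_def ext_def)
    \<comment> \<open>Since \<open>\<phi> u\<close> has values in \<open>A\<close>, the new point
      \<open>b\<close> is missed unless \<open>v = b\<close>.\<close>
    moreover have "\<phi> u ` A \<subseteq> A"
      using bij_betwE[OF \<phi>] uv(1) by (auto simp: PiE_iff)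
    ultimately have "insert b A - \<psi> w ` insert b A = insert b (A - \<phi> u ` A) - {v}"
      using b by (auto simp: fun_upd_image)
    also have "\<dots> = descent_bottoms w"
      using uv less descent_bottoms_insert_before[of u b v] db[OF uv(1)]
      by (simp add: permutations_of_set_def)
    finally show ?thesis .
  qed
  ultimately show ?case by blast
qed

section \<open>From words back to permutations and their descents\<close>

lemma bij_betw_permutes_permutations_of_set:
  "bij_betw (\<lambda>\<pi>. map \<pi> xs) {\<pi>. \<pi> permutes set xs} (permutations_of_set (set xs))"
  if "distinct xs"
proof -
  have inj: "inj_on (\<lambda>\<pi>. map \<pi> xs) {\<pi>. \<pi> permutes set xs}"
  proof (rule inj_onI, rule ext)
    fix \<pi> \<sigma> x assume *: "\<pi> \<in> {\<pi>. \<pi> permutes set xs}" "\<sigma> \<in> {\<pi>. \<pi> permutes set xs}"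
      "map \<pi> xs = map \<sigma> xs"
    then show "\<pi> x = \<sigma> x"
      by (cases "x \<in> set xs") (auto simp: permutes_not_in)
  qed
  have sub: "(\<lambda>\<pi>. map \<pi> xs) ` {\<pi>. \<pi> permutes set xs} \<subseteq> permutations_of_set (set xs)"
    using that
    by (auto simp: permutations_of_set_def distinct_map permutes_image permutes_inj_on simp flip: image_set)
  \<comment> \<open>Surjectivity follows by counting: both sets have
    \<open>fact (card (set xs))\<close> elements.\<close>
  have "card ((\<lambda>\<pi>. map \<pi> xs) ` {\<pi>. \<pi> permutes set xs}) = card (permutations_of_set (set xs))"
    by (simp add: card_image[OF inj] card_permutations)
  then show ?thesis
    using inj sub by (simp add: bij_betw_def card_subset_eq)
qed

lemma descent_bottoms_map_upt:
  "descent_bottoms (map \<pi> [1..<Suc n]) = {\<pi> (i + 1) |i. i \<in> descents n \<pi>}"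
proof -
  have nth: "map \<pi> [1..<Suc n] ! i = \<pi> (Suc i)" if "i < n" for i
    using that by (simp del: upt_Suc)
  \<comment> \<open>List positions start at 0 and descents at 1, so position \<open>i\<close> of the
    word corresponds to the index \<open>Suc i\<close>.\<close>
  have "descent_bottoms (map \<pi> [1..<Suc n]) =
      {\<pi> (Suc i + 1) |i. Suc i < n \<and> \<pi> (Suc i + 1) < \<pi> (Suc i)}"
    unfolding descent_bottoms_conv_nth
    by (intro Collect_cong arg_cong[where f = Ex] ext) (auto simp: nth simp del: upt_Suc)
  also have "\<dots> = {\<pi> (i + 1) |i. i \<in> descents n \<pi>}"
  proof (intro equalityI subsetI)
    fix k assume "k \<in> {\<pi> (i + 1) |i. i \<in> descents n \<pi>}"
    then obtain i where "i \<in> descents n \<pi>" "k = \<pi> (i + 1)" by blast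
    then show "k \<in> {\<pi> (Suc i + 1) |i. Suc i < n \<and> \<pi> (Suc i + 1) < \<pi> (Suc i)}"
      \<comment> \<open>The index 0 is excluded by \<open>descents\<close>, so \<open>i\<close> is a
        successor.\<close>
      by (cases i) (auto simp: descents_def)
  qed (fastforce simp: descents_def)
  finally show ?thesis .
qed

theorem theorem6p4:
  fixes n :: nat
  shows "\<exists>\<Phi> :: (nat \<Rightarrow> nat) \<Rightarrow> (nat \<Rightarrow> nat).
           bij_betw \<Phi> {\<pi>. \<pi> permutes {1..n}} (excedant_funs n) \<and>
           (\<forall>\<pi>. \<pi> permutes {1..n} \<longrightarrow>
             (\<forall>k\<in>{1..n}. k \<notin> \<Phi> \<pi> ` {1..n} \<longleftrightarrow> (\<exists>i\<in>descents n \<pi>. \<pi> (i + 1) = k)))"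
proof -
  obtain \<phi> where \<phi>: "bij_betw \<phi> (permutations_of_set {1..n}) (excedant_funs n)"
    and db: "\<And>w. w \<in> permutations_of_set {1..n} \<Longrightarrow> {1..n} - \<phi> w ` {1..n} = descent_bottoms w"
    using ex_bij_permutations_excedant[of "{1..n}"] unfolding excedant_funs_def by auto
  \<comment> \<open>One-line notation of the permutation.\<close>
  define word where "word \<pi> = map \<pi> [1..<Suc n]" for \<pi> :: "nat \<Rightarrow> nat"
  have "set [1..<Suc n] = {1..n}" by auto
  then have word: "bij_betw word {\<pi>. \<pi> permutes {1..n}} (permutations_of_set {1..n})"
    using bij_betw_permutes_permutations_of_set[of "[1..<Suc n]"]
    unfolding word_def by (simp del: upt_Suc)
  show ?thesis
  proof (intro exI[of _ "\<phi> \<circ> word"] conjI allI impI ballI)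
    show "bij_betw (\<phi> \<circ> word) {\<pi>. \<pi> permutes {1..n}} (excedant_funs n)"
      using word \<phi> by (rule bij_betw_trans)
  next
    fix \<pi> k assume "\<pi> permutes {1..n}" and k: "k \<in> {1..n}"
    then have "{1..n} - \<phi> (word \<pi>) ` {1..n} = {\<pi> (i + 1) |i. i \<in> descents n \<pi>}"
      using db[of "word \<pi>"] bij_betwE[OF word] descent_bottoms_map_upt[of \<pi> n]
      by (simp add: word_def del: upt_Suc)
    from eqset_imp_iff[OF this, of k]
    have "k \<notin> \<phi> (word \<pi>) ` {1..n} \<longleftrightarrow> (\<exists>i. k = \<pi> (i + 1) \<and> i \<in> descents n \<pi>)"
      using k by (simp only: Diff_iff mem_Collect_eq simp_thms)
    then show "k \<notin> (\<phi> \<circ> word) \<pi> ` {1..n} \<longleftrightarrow> (\<exists>i\<in>descents n \<pi>. \<pi> (i + 1) = k)"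
      by (metis comp_apply)
  qed
qed

end
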